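(* Let $n\ge 1$ and let $g$ be the Semi-Riemannian metric on $GL_n=GL_n(\mathbb{R})$ given by $g_A(V,W)=\mathrm{tr}(A^{-1}VA^{-1}W)$ for $A\in GL_n$, $V,W\in T_A(GL_n)=M_n(\mathbb{R})$. 1) For $C\in M_n(\mathbb{R})$ and $K\in GL_n$, the curve $P(t)=Ke^{tC}$ is the unique geodesic of $(GL_n,g)$ emanating from $K$ with velocity $KC$ at $t=0$; and vice versa, the unique geodesic of $(GL_n,g)$ emanating from $K\in GL_n$ with velocity $S\in M_n(\mathbb{R})$ at $t=0$ is $P(t)=K\exp(tK^{-1}S)$. 2) Let $K_0,K_1\in GL_n$. There exists a geodesic arc in $(GL_n,g)$ joining $K_0$ and $K_1$ if and only if the exponential equation $\exp(X)=K_0^{-1}K_1$ has a real solution $X=C\in M_n(\mathbb{R})$; moreover the real solutions correspond bijectively to the geodesics of $(GL_n,g)$ starting from $K_0$ at $t=0$ and passing through $K_1$ at $t=1$. 3) If $K$ is a positive definite symmetric real $n\times n$ matrix, $K^{1/2}$ denotes its unique positive definite square root, and $S$ is a real symmetric $n\times n$ matrix, then the unique geodesic emanating from $K$ with velocity $S$ at $t=0$ is $P(t)=K^{1/2}\exp\left(tK^{-1/2}SK^{-1/2}\right)K^{1/2}$.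
   Context: $M_n(\mathbb{R})$ is the space of real $n\times n$ matrices. A geodesic arc joining $K_0$ and $K_1$ is any geodesic $\gamma:[0,1]\to GL_n$ of $(GL_n,g)$ with $\gamma(0)=K_0$ and $\gamma(1)=K_1$ (constant curves are regarded as geodesics). $K^{-1/2}$ denotes the inverse of $K^{1/2}$. *)

theory Defs
  imports "HOL-Analysis.Analysis"
begin

section \<open>Levi-Civita connection and geodesics on an open subset of a Euclidean space\<close>

text \<open>
  Throughout, \<open>U\<close> is an open subset of a Euclidean space \<open>'a\<close>, every tangent space \<open>T\<^sub>p U\<close> is
  identified with \<open>'a\<close>, vector fields are functions \<open>'a \<Rightarrow> 'a\<close>, and a metric is a family \<open>g p\<close> of
  bilinear forms. An affine connection on \<open>U\<close> has the form \<open>(\<nabla>\<^sub>X Y)(p) = DY\<^sub>p(X p) + \<Gamma>\<^sub>p(X p, Y p)\<close>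
  for a unique field \<open>\<Gamma>\<close> of bilinear maps (the Christoffel symbols in the global chart).
\<close>

definition cov_deriv ::
  "('a::euclidean_space \<Rightarrow> 'a \<Rightarrow> 'a \<Rightarrow> 'a) \<Rightarrow> ('a \<Rightarrow> 'a) \<Rightarrow> ('a \<Rightarrow> 'a) \<Rightarrow> 'a \<Rightarrow> 'a" where
  "cov_deriv \<Gamma> X Y p = frechet_derivative Y (at p) (X p) + \<Gamma> p (X p) (Y p)"

definition lie_bracket :: "('a::euclidean_space \<Rightarrow> 'a) \<Rightarrow> ('a \<Rightarrow> 'a) \<Rightarrow> 'a \<Rightarrow> 'a" where
  "lie_bracket X Y p = frechet_derivative Y (at p) (X p) - frechet_derivative X (at p) (Y p)"

text \<open>
  The two identities below depend only on the first-order behaviour of the fields at \<open>p\<close>, so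
  quantifying over fields differentiable at \<open>p\<close> is the same as quantifying over smooth fields.
  For a smooth nondegenerate \<open>g\<close> exactly one \<open>\<Gamma>\<close> (up to its values outside \<open>U\<close>) satisfies them,
  and it is smooth on \<open>U\<close>.
\<close>

definition torsion_free :: "'a::euclidean_space set \<Rightarrow> ('a \<Rightarrow> 'a \<Rightarrow> 'a \<Rightarrow> 'a) \<Rightarrow> bool" where
  "torsion_free U \<Gamma> \<longleftrightarrow>
     (\<forall>p\<in>U. \<forall>X Y. X differentiable (at p) \<longrightarrow> Y differentiable (at p) \<longrightarrow>
        cov_deriv \<Gamma> X Y p - cov_deriv \<Gamma> Y X p = lie_bracket X Y p)"

definition metric_compatible ::
  "'a::euclidean_space set \<Rightarrow> ('a \<Rightarrow> 'a \<Rightarrow> 'a \<Rightarrow> real) \<Rightarrow> ('a \<Rightarrow> 'a \<Rightarrow> 'a \<Rightarrow> 'a) \<Rightarrow> bool" where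
  "metric_compatible U g \<Gamma> \<longleftrightarrow>
     (\<forall>p\<in>U. \<forall>X Y Z. X differentiable (at p) \<longrightarrow> Y differentiable (at p) \<longrightarrow> Z differentiable (at p) \<longrightarrow>
        frechet_derivative (\<lambda>q. g q (Y q) (Z q)) (at p) (X p) =
          g p (cov_deriv \<Gamma> X Y p) (Z p) + g p (Y p) (cov_deriv \<Gamma> X Z p))"

definition levi_civita ::
  "'a::euclidean_space set \<Rightarrow> ('a \<Rightarrow> 'a \<Rightarrow> 'a \<Rightarrow> real) \<Rightarrow> ('a \<Rightarrow> 'a \<Rightarrow> 'a \<Rightarrow> 'a) \<Rightarrow> bool" where
  "levi_civita U g \<Gamma> \<longleftrightarrow>
     (\<forall>p\<in>U. bilinear (\<Gamma> p)) \<and> torsion_free U \<Gamma> \<and> metric_compatible U g \<Gamma>"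

text \<open>At endpoints belonging to \<open>J\<close>, derivatives of curves are one-sided.\<close>

definition smooth_curve_on :: "real set \<Rightarrow> (real \<Rightarrow> 'a::euclidean_space) \<Rightarrow> bool" where
  "smooth_curve_on J \<gamma> \<longleftrightarrow>
     (\<exists>D :: nat \<Rightarrow> real \<Rightarrow> 'a. D 0 = \<gamma> \<and>
        (\<forall>k. \<forall>t\<in>J. (D k has_vector_derivative D (Suc k) t) (at t within J)))"

definition velocity :: "real set \<Rightarrow> (real \<Rightarrow> 'a::euclidean_space) \<Rightarrow> real \<Rightarrow> 'a" where
  "velocity J \<gamma> t = vector_derivative \<gamma> (at t within J)"

definition cov_deriv_along ::
  "('a::euclidean_space \<Rightarrow> 'a \<Rightarrow> 'a \<Rightarrow> 'a) \<Rightarrow> real set \<Rightarrow> (real \<Rightarrow> 'a) \<Rightarrow> (real \<Rightarrow> 'a) \<Rightarrow> real \<Rightarrow> 'a" where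
  "cov_deriv_along \<Gamma> J \<gamma> V t =
     vector_derivative V (at t within J) + \<Gamma> (\<gamma> t) (velocity J \<gamma> t) (V t)"

definition geodesic_on ::
  "'a::euclidean_space set \<Rightarrow> ('a \<Rightarrow> 'a \<Rightarrow> 'a \<Rightarrow> real) \<Rightarrow> real set \<Rightarrow> (real \<Rightarrow> 'a) \<Rightarrow> bool" where
  "geodesic_on U g J \<gamma> \<longleftrightarrow>
     is_interval J \<and> interior J \<noteq> {} \<and> \<gamma> ` J \<subseteq> U \<and> smooth_curve_on J \<gamma> \<and>
     (\<exists>\<Gamma>. levi_civita U g \<Gamma> \<and> (\<forall>t\<in>J. cov_deriv_along \<Gamma> J \<gamma> (velocity J \<gamma>) t = 0))"

text \<open>
  \<open>P\<close> is a geodesic on the whole real line with the given initial data, and every geodesic with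
  these data, on whatever interval around or starting or ending at \<open>0\<close>, is a restriction of \<open>P\<close>.
\<close>

definition unique_geodesic_from ::
  "'a::euclidean_space set \<Rightarrow> ('a \<Rightarrow> 'a \<Rightarrow> 'a \<Rightarrow> real) \<Rightarrow> 'a \<Rightarrow> 'a \<Rightarrow> (real \<Rightarrow> 'a) \<Rightarrow> bool" where
  "unique_geodesic_from U g K S P \<longleftrightarrow>
     geodesic_on U g UNIV P \<and> P 0 = K \<and> velocity UNIV P 0 = S \<and>
     (\<forall>J \<gamma>. geodesic_on U g J \<gamma> \<and> 0 \<in> J \<and> \<gamma> 0 = K \<and> velocity J \<gamma> 0 = S \<longrightarrow>
        (\<forall>t\<in>J. \<gamma> t = P t))"

definition geodesic_arc ::
  "'a::euclidean_space set \<Rightarrow> ('a \<Rightarrow> 'a \<Rightarrow> 'a \<Rightarrow> real) \<Rightarrow> 'a \<Rightarrow> 'a \<Rightarrow> (real \<Rightarrow> 'a) \<Rightarrow> bool" where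
  "geodesic_arc U g K0 K1 \<gamma> \<longleftrightarrow> geodesic_on U g {0..1} \<gamma> \<and> \<gamma> 0 = K0 \<and> \<gamma> 1 = K1"

section \<open>The general linear group with the trace metric\<close>

definition GL :: "(real^'n^'n) set" where
  "GL = {A. invertible A}"

definition trace_metric :: "real^'n^'n \<Rightarrow> real^'n^'n \<Rightarrow> real^'n^'n \<Rightarrow> real" where
  "trace_metric A V W = trace (matrix_inv A ** V ** matrix_inv A ** W)"

text \<open>The class operations \<open>*\<close> and \<open>^\<close> on \<open>real^'n^'n\<close> act entrywise, hence the definitions below.\<close>

primrec matrix_pow :: "real^'n^'n \<Rightarrow> nat \<Rightarrow> real^'n^'n" where
  "matrix_pow A 0 = mat 1"
| "matrix_pow A (Suc k) = A ** matrix_pow A k"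

definition matrix_exp :: "real^'n^'n \<Rightarrow> real^'n^'n" where
  "matrix_exp A = (\<Sum>k. (1 / fact k) *\<^sub>R matrix_pow A k)"

definition symmetric_matrix :: "real^'n^'n \<Rightarrow> bool" where
  "symmetric_matrix A \<longleftrightarrow> transpose A = A"

definition pos_def_matrix :: "real^'n^'n \<Rightarrow> bool" where
  "pos_def_matrix A \<longleftrightarrow> symmetric_matrix A \<and> (\<forall>x. x \<noteq> 0 \<longrightarrow> x \<bullet> (A *v x) > 0)"

definition matrix_sqrt :: "real^'n^'n \<Rightarrow> real^'n^'n" where
  "matrix_sqrt K = (THE R. pos_def_matrix R \<and> R ** R = K)"

end

theory Submission
  imports Defs
begin

text \<open>
  The Levi-Civita connection of the trace metric has Christoffel symbols
  \<open>\<Gamma>\<^sub>A(V, W) = - (V A\<^sup>-\<^sup>1 W + W A\<^sup>-\<^sup>1 V) / 2\<close>, so the geodesic equation reads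
  \<open>\<gamma>'' = \<gamma>' \<gamma>\<^sup>-\<^sup>1 \<gamma>'\<close>, which says exactly that \<open>C = \<gamma>\<^sup>-\<^sup>1 \<gamma>'\<close> is constant. Then
  \<open>\<gamma> exp(- t C)\<close> is constant as well, and the geodesics are the curves \<open>K exp(t C)\<close>.
\<close>

text \<open>\<open>geodesic_on\<close> provides only some Levi-Civita \<open>\<Gamma>\<close>, so
  uniqueness of the connection is what turns a given geodesic into a solution of the explicit
  equation. No theory of differential equations enters: a geodesic is integrated by two functions
  with zero derivative on the convex set \<open>J\<close>, which treats open, closed and unbounded
  intervals alike, and every uniqueness claim about geodesics comes from comparing two exponential
  curves at \<open>0\<close>. The formula for positive definite \<open>K\<close> describes the same
  curves, because \<open>matrix_sqrt K\<close> intertwines the two exponents. The work there is the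
  existence of the root, obtained without diagonalization: after scaling, \<open>1 - e K\<close> has
  operator norm below 1 and a fixed point argument applies. The entrywise Euclidean norm of
  \<open>1 - e K\<close> may exceed 1; hence the passage from matrices to bounded operators.\<close>

lemma bounded_bilinear_matrix_mult:
  "bounded_bilinear ((**) :: real^'m^'n \<Rightarrow> real^'p^'m \<Rightarrow> real^'p^'n)"
  unfolding bilinear_conv_bounded_bilinear[symmetric] bilinear_def
  by (auto intro!: linearI simp: matrix_add_ldistrib matrix_matrix_mult_def
      vec_eq_iff sum.distrib sum_distrib_left algebra_simps)

interpretation matrix_mult: bounded_bilinear "(**) :: real^'m^'n \<Rightarrow> real^'p^'m \<Rightarrow> real^'p^'n"
  by (rule bounded_bilinear_matrix_mult)

lemmas has_vector_derivative_matrix_mult =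
  bounded_bilinear.has_vector_derivative[OF bounded_bilinear_matrix_mult]

lemmas matrix_mult_simps = matrix_mult.add_left matrix_mult.add_right matrix_mult.diff_left
  matrix_mult.diff_right matrix_mult.minus_left matrix_mult.minus_right matrix_mult.scaleR_left
  matrix_mult.scaleR_right

lemma bounded_linear_vec_nth2: "bounded_linear (\<lambda>A :: real^'m^'n. A $ i $ j)"
  by (rule bounded_linear_compose[OF bounded_linear_vec_nth bounded_linear_vec_nth])

section \<open>Cancellation rules for the matrix inverse\<close>

lemma matrix_inv_right: "invertible (A :: 'a::semiring_1^'n^'m) \<Longrightarrow> A ** matrix_inv A = mat 1"
  and matrix_inv_left: "invertible (A :: 'a::semiring_1^'n^'m) \<Longrightarrow> matrix_inv A ** A = mat 1"
  unfolding invertible_def matrix_inv_def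
  by (drule someI_ex; simp)+

lemma matrix_inv_cancel:
  fixes A :: "'a::semiring_1^'n^'m"
  assumes "invertible A"
  shows "A ** (matrix_inv A ** B) = B" "matrix_inv A ** (A ** C) = C"
    "D ** A ** matrix_inv A = D" "E ** matrix_inv A ** A = E"
  by (simp_all add: assms matrix_mul_assoc matrix_inv_left matrix_inv_right
      matrix_mul_assoc[symmetric, of D] matrix_mul_assoc[symmetric, of E])

lemma matrix_eq_inv_mult_iff:
  fixes A :: "'a::semiring_1^'n^'m"
  assumes "invertible A"
  shows "B = matrix_inv A ** C \<longleftrightarrow> A ** B = C"
  by (auto simp: matrix_inv_cancel assms)

lemma matrix_mult_left_cancel:
  fixes A :: "'a::semiring_1^'n^'m"
  assumes "invertible A"
  shows "A ** B = A ** C \<longleftrightarrow> B = C"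
  by (auto simp: matrix_inv_cancel assms simp flip: matrix_eq_inv_mult_iff[OF assms])

section \<open>The matrix exponential\<close>

lemma matrix_pow_commute: "matrix_pow (A :: real^'n^'n) k ** A = A ** matrix_pow A k"
  by (induction k) (simp_all add: matrix_mul_assoc[symmetric])

lemma matrix_pow_intertwine:
  fixes A B P :: "real^'n^'n"
  assumes "A ** P = P ** B"
  shows "matrix_pow A k ** P = P ** matrix_pow B k"
proof (induction k)
  case (Suc k)
  have "matrix_pow A (Suc k) ** P = A ** P ** matrix_pow B k"
    by (simp add: matrix_mul_assoc[symmetric] Suc)
  then show ?case by (simp add: assms matrix_mul_assoc)
qed simp

lemma matrix_pow_scaleR: "matrix_pow (t *\<^sub>R (A :: real^'n^'n)) k = t ^ k *\<^sub>R matrix_pow A k"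
  by (induction k) (simp_all add: matrix_mult_simps)

lemma summable_matrix_exp: "summable (\<lambda>k. (1 / fact k) *\<^sub>R matrix_pow (A :: real^'n^'n) k)"
proof -
  \<comment> \<open>The constant of bounded bilinearity stands in for submultiplicativity of the
    norm; it only changes the argument of the dominating exponential series.\<close>
  obtain c where c: "c > 0" "\<And>(X :: real^'n^'n) (Y :: real^'n^'n). norm (X ** Y) \<le> norm X * norm Y * c"
    using matrix_mult.pos_bounded by blast
  have bound: "norm (matrix_pow A k) \<le> norm (mat 1 :: real^'n^'n) * (norm A * c) ^ k" for k
  proof (induction k)
    case (Suc k)
    have "norm (matrix_pow A (Suc k)) \<le> (norm A * c) * norm (matrix_pow A k)"
      using c(2)[of A "matrix_pow A k"] by (simp add: mult_ac)
    also have "\<dots> \<le> (norm A * c) * (norm (mat 1 :: real^'n^'n) * (norm A * c) ^ k)"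
      using Suc c(1) by (intro mult_left_mono) auto
    finally show ?case by (simp add: mult_ac)
  qed simp
  show ?thesis
  proof (rule summable_comparison_test'[where N = 0])
    show "summable (\<lambda>k. norm (mat 1 :: real^'n^'n) * ((norm A * c) ^ k /\<^sub>R fact k))"
      by (intro summable_mult summable_exp_generic)
    show "norm ((1 / fact k) *\<^sub>R matrix_pow A k) \<le> norm (mat 1 :: real^'n^'n) * ((norm A * c) ^ k /\<^sub>R fact k)" for k
      using mult_left_mono[OF bound, of "1 / fact k" k] by (simp add: field_simps)
  qed
qed

text \<open>Turns the exponential into real power series in \<open>t\<close>, so that termwise
  differentiation of scalar series applies. The functionals of interest are
  \<open>X \<mapsto> X $ i $ j\<close> and \<open>X \<mapsto> (X ** A) $ i $ j\<close>.\<close>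

lemma bounded_linear_matrix_exp_sums:
  fixes A :: "real^'n^'n" and L :: "real^'n^'n \<Rightarrow> real"
  assumes "bounded_linear L"
  shows "(\<lambda>k. (L (matrix_pow A k) / fact k) * t ^ k) sums L (matrix_exp (t *\<^sub>R A))"
proof -
  interpret L: bounded_linear L by fact
  show ?thesis
    using L.sums[OF summable_sums[OF summable_matrix_exp[of "t *\<^sub>R A"]]]
    by (simp add: matrix_exp_def matrix_pow_scaleR L.scaleR mult_ac)
qed

text \<open>The relation passes to powers and then, by continuity of multiplication, to the series.
  With \<open>P = A\<close> it makes \<open>A\<close> commute with
  \<open>matrix_exp (t *\<^sub>R A)\<close>; with \<open>P\<close> a square root of \<open>K\<close>
  it yields the symmetric form of the geodesics.\<close>

lemma matrix_exp_intertwine: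
  fixes A B P :: "real^'n^'n"
  assumes "A ** P = P ** B"
  shows "matrix_exp A ** P = P ** matrix_exp B"
proof -
  have "matrix_exp A ** P = (\<Sum>k. ((1 / fact k) *\<^sub>R matrix_pow A k) ** P)"
    unfolding matrix_exp_def
    by (rule bounded_linear.suminf[OF matrix_mult.bounded_linear_left summable_matrix_exp])
  also have "\<dots> = (\<Sum>k. P ** ((1 / fact k) *\<^sub>R matrix_pow B k))"
    by (simp add: matrix_mult_simps matrix_pow_intertwine[OF assms])
  also have "\<dots> = P ** matrix_exp B"
    unfolding matrix_exp_def
    by (rule bounded_linear.suminf[OF matrix_mult.bounded_linear_right summable_matrix_exp, symmetric])
  finally show ?thesis .
qed

lemma matrix_exp_0: "matrix_exp 0 = (mat 1 :: real^'n^'n)"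
proof -
  have "(1 / fact k) *\<^sub>R matrix_pow (0 :: real^'n^'n) k = (if k = 0 then mat 1 else 0)" for k
    by (cases k) auto
  then have "matrix_exp 0 = (\<Sum>k\<in>{0}. (1 / fact k) *\<^sub>R matrix_pow (0 :: real^'n^'n) k)"
    unfolding matrix_exp_def by (intro suminf_finite) auto
  then show ?thesis by simp
qed

lemma matrix_exp_has_vector_derivative:
  fixes A :: "real^'n^'n"
  shows "((\<lambda>t. matrix_exp (t *\<^sub>R A)) has_vector_derivative matrix_exp (t *\<^sub>R A) ** A) (at t within J)"
proof (rule has_vector_derivative_at_within)
  have entry: "((\<lambda>t. matrix_exp (t *\<^sub>R A) $ i $ j) has_field_derivative
      (matrix_exp (t *\<^sub>R A) ** A) $ i $ j) (at t)" for i j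
  proof -
    define c where "c k = matrix_pow A k $ i $ j / fact k" for k
    have sums: "(\<lambda>k. c k * x ^ k) sums (matrix_exp (x *\<^sub>R A) $ i $ j)" for x
      unfolding c_def by (rule bounded_linear_matrix_exp_sums[OF bounded_linear_vec_nth2])
    \<comment> \<open>The factor \<open>k + 1\<close> cancels against \<open>fact (k + 1)\<close>,
      so the differentiated series is the series of the functional
      \<open>X \<mapsto> (X ** A) $ i $ j\<close>.\<close>
    have "diffs c k = (matrix_pow A k ** A) $ i $ j / fact k" for k
      by (simp add: diffs_def c_def matrix_pow_commute[symmetric] field_simps del: of_nat_Suc)
    then have "(\<Sum>k. diffs c k * t ^ k) = (matrix_exp (t *\<^sub>R A) ** A) $ i $ j"
      using bounded_linear_matrix_exp_sums[where A = A and t = t, THEN sums_unique,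
          OF bounded_linear_compose[OF bounded_linear_vec_nth2[of i j] matrix_mult.bounded_linear_left[of A]]]
      by simp
    then show ?thesis
      using termdiffs_strong_converges_everywhere[of c t] sums[THEN sums_summable] sums[THEN sums_unique]
      by simp
  qed
  show "((\<lambda>t. matrix_exp (t *\<^sub>R A)) has_vector_derivative matrix_exp (t *\<^sub>R A) ** A) (at t)"
    unfolding has_vector_derivative_def
  proof (subst has_derivative_componentwise_within, rule ballI)
    fix e :: "real^'n^'n" assume "e \<in> Basis"
    then obtain i j where e: "e = axis i (axis j 1)"
      by (auto simp: Basis_vec_def)
    show "((\<lambda>t. matrix_exp (t *\<^sub>R A) \<bullet> e) has_derivative (\<lambda>x. (x *\<^sub>R (matrix_exp (t *\<^sub>R A) ** A)) \<bullet> e)) (at t)"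
      using entry[of i j] by (simp add: e inner_axis has_field_derivative_def mult.commute[of _ "_ $ _ $ _"])
  qed
qed

lemma matrix_exp_commute: "matrix_exp (t *\<^sub>R A) ** A = A ** matrix_exp (t *\<^sub>R (A :: real^'n^'n))"
  by (rule matrix_exp_intertwine) (simp add: matrix_mult_simps)

lemma matrix_exp_minus_has_vector_derivative:
  fixes A :: "real^'n^'n"
  shows "((\<lambda>t. matrix_exp ((- t) *\<^sub>R A)) has_vector_derivative - (A ** matrix_exp ((- t) *\<^sub>R A))) (at t within J)"
  using matrix_exp_has_vector_derivative[of "- A" t J] matrix_exp_commute[of "-t" A]
  by (simp add: matrix_mult_simps)

text \<open>By the product rule the two factors contribute the same matrix with opposite signs, so
  the product keeps its value at \<open>t = 0\<close>.\<close>

lemma matrix_exp_mult_minus: "matrix_exp (t *\<^sub>R A) ** matrix_exp ((- t) *\<^sub>R A) = (mat 1 :: real^'n^'n)"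
proof -
  let ?f = "\<lambda>t. matrix_exp (t *\<^sub>R A) ** matrix_exp ((- t) *\<^sub>R A)"
  have "(?f has_vector_derivative 0) (at t within UNIV)" for t
    using has_vector_derivative_matrix_mult[OF matrix_exp_has_vector_derivative[of A t UNIV]
        matrix_exp_minus_has_vector_derivative[of A t UNIV]]
    by (simp add: matrix_mult_simps matrix_mul_assoc)
  then obtain c where "\<And>x. ?f x = c"
    using has_vector_derivative_zero_constant[of UNIV ?f] by auto
  then have "?f t = ?f 0" by metis
  then show ?thesis by (simp add: matrix_exp_0)
qed

lemma matrix_exp_minus_mult: "matrix_exp ((- t) *\<^sub>R A) ** matrix_exp (t *\<^sub>R A) = (mat 1 :: real^'n^'n)"
  using matrix_exp_mult_minus[of "- t" A] by simp

lemma invertible_matrix_exp: "invertible (matrix_exp (t *\<^sub>R (A :: real^'n^'n)))"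
  using matrix_exp_mult_minus matrix_exp_minus_mult invertible_def by blast

section \<open>The derivative of matrix inversion\<close>

lemma open_GL: "open (GL :: (real^'n^'n) set)"
proof -
  have "continuous_on UNIV (det :: real^'n^'n \<Rightarrow> real)"
    unfolding det_def by (intro continuous_intros)
  then have "open ((det :: real^'n^'n \<Rightarrow> real) -` (- {0}))"
    by (intro open_vimage) auto
  also have "(det :: real^'n^'n \<Rightarrow> real) -` (- {0}) = GL"
    by (auto simp: GL_def invertible_det_nz)
  finally show ?thesis .
qed

lemma matrix_inv_diff:
  fixes A B :: "real^'n^'n"
  assumes "invertible A" "invertible B"
  shows "matrix_inv B - matrix_inv A = - (matrix_inv B ** (B - A) ** matrix_inv A)"
  by (simp add: matrix_mult_simps matrix_inv_cancel assms matrix_inv_left)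

text \<open>Applying \<open>matrix_inv_diff\<close> twice writes the remainder as
  \<open>B^-1 (B - A) A^-1 (B - A) A^-1\<close>, which is quadratic in \<open>B - A\<close> once
  \<open>B^-1\<close> is bounded near \<open>A\<close>.\<close>

lemma matrix_inv_has_derivative:
  fixes A :: "real^'n^'n"
  assumes "A \<in> GL"
  shows "(matrix_inv has_derivative (\<lambda>H. - (matrix_inv A ** H ** matrix_inv A))) (at A)"
proof -
  have A: "invertible A" using assms by (simp add: GL_def)
  obtain c where c: "c > 0" "\<And>(X :: real^'n^'n) (Y :: real^'n^'n). norm (X ** Y) \<le> norm X * norm Y * c"
    using matrix_mult.pos_bounded by blast
  have c3: "norm (X ** Y ** Z) \<le> norm X * norm Y * norm Z * c\<^sup>2" for X Y Z :: "real^'n^'n"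
  proof -
    have "norm (X ** Y ** Z) \<le> norm (X ** Y) * norm Z * c" by (rule c)
    also have "\<dots> \<le> (norm X * norm Y * c) * norm Z * c"
      using c by (intro mult_right_mono) auto
    finally show ?thesis by (simp add: power2_eq_square mult_ac)
  qed
  define a where "a = norm (matrix_inv A)"
  obtain e where e: "e > 0" "ball A e \<subseteq> GL"
    using open_GL assms open_contains_ball by blast
  \<comment> \<open>The radius \<open>e\<close> keeps \<open>B\<close> invertible. The second bound
    gives \<open>a * norm (B - A) * c\<^sup>2 \<le> 1 / 2\<close>, so
    \<open>b = norm (matrix_inv B)\<close> satisfies \<open>b \<le> a + b / 2\<close>, that is
    \<open>b \<le> 2 * a\<close>; this is the \<open>2 * a\<close> inside the constant
    \<open>2 * a ^ 3 * c ^ 4\<close>. The \<open>+ 1\<close> makes the denominator positive from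
    \<open>a \<ge> 0\<close> alone.\<close>
  define d where "d = min e (1 / (2 * (a * c\<^sup>2 + 1)))"
  have a0: "a \<ge> 0" by (simp add: a_def)
  have pos: "0 < a * c\<^sup>2 + 1" using a0 by (intro add_nonneg_pos) auto
  then have "d > 0" using e by (simp add: d_def)
  show ?thesis
  proof (rule has_derivativeI_sandwich[OF \<open>d > 0\<close>, where H = "\<lambda>B. (2 * a ^ 3 * c ^ 4) * norm (B - A)"])
    show "bounded_linear (\<lambda>H. - (matrix_inv A ** H ** matrix_inv A))"
      by (intro bounded_linear_minus bounded_linear_compose[OF matrix_mult.bounded_linear_left
            matrix_mult.bounded_linear_right])
    show "((\<lambda>B. (2 * a ^ 3 * c ^ 4) * norm (B - A)) \<longlongrightarrow> 0) (at A)"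
      by (auto intro!: tendsto_eq_intros)
    fix B assume B: "B \<noteq> A" "dist B A < d"
    then have invB: "invertible B"
      using e by (auto simp: d_def GL_def dist_commute)
    define w where "w = a * c\<^sup>2 + 1"
    have w: "w > 0" using pos by (simp add: w_def)
    have "a * norm (B - A) * c\<^sup>2 \<le> norm (B - A) * w"
      by (simp add: algebra_simps w_def)
    also have "\<dots> \<le> (1 / (2 * w)) * w"
      using B w by (intro mult_right_mono) (auto simp: d_def dist_norm w_def)
    finally have half: "a * norm (B - A) * c\<^sup>2 \<le> 1 / 2" using w by simp
    define b where "b = norm (matrix_inv B)"
    have "b \<le> a + norm (matrix_inv B - matrix_inv A)"
      unfolding a_def b_def by (metis norm_triangle_sub)
    also have "\<dots> \<le> a + b * norm (B - A) * a * c\<^sup>2"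
      using c3[of "matrix_inv B" "B - A" "matrix_inv A"]
      by (simp add: matrix_inv_diff[OF A invB] a_def b_def)
    also have "\<dots> = a + b * (a * norm (B - A) * c\<^sup>2)" by (simp add: mult_ac)
    also have "\<dots> \<le> a + b * (1 / 2)"
      using half by (intro add_left_mono mult_left_mono) (auto simp: b_def)
    finally have b: "b \<le> 2 * a" by simp
    have "matrix_inv B - matrix_inv A - - (matrix_inv A ** (B - A) ** matrix_inv A) =
      - ((matrix_inv B - matrix_inv A) ** (B - A) ** matrix_inv A)"
      by (subst matrix_inv_diff[OF A invB]) (simp add: matrix_mult.diff_left)
    also have "\<dots> = (matrix_inv B ** (B - A) ** matrix_inv A) ** (B - A) ** matrix_inv A"
      by (subst matrix_inv_diff[OF A invB]) (simp add: matrix_mult.minus_left)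
    finally have "norm (matrix_inv B - matrix_inv A - - (matrix_inv A ** (B - A) ** matrix_inv A))
      \<le> norm (matrix_inv B ** (B - A) ** matrix_inv A) * norm (B - A) * a * c\<^sup>2"
      using c3 by (simp add: a_def)
    also have "\<dots> \<le> (b * norm (B - A) * a * c\<^sup>2) * norm (B - A) * a * c\<^sup>2"
      using c3 a0 by (intro mult_right_mono) (auto simp: a_def b_def)
    also have "\<dots> = b * (a\<^sup>2 * c ^ 4 * (norm (B - A))\<^sup>2)" by (simp add: power2_eq_square power4_eq_xxxx)
    also have "\<dots> \<le> (2 * a) * (a\<^sup>2 * c ^ 4 * (norm (B - A))\<^sup>2)"
      using b by (intro mult_right_mono) auto
    finally show "norm (matrix_inv B - matrix_inv A - - (matrix_inv A ** (B - A) ** matrix_inv A)) / norm (B - A)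
      \<le> (2 * a ^ 3 * c ^ 4) * norm (B - A)"
      using B by (simp add: field_simps power2_eq_square power3_eq_cube)
  qed
qed

section \<open>The Levi-Civita connection of the trace metric\<close>

text \<open>Constant fields suffice as test fields for uniqueness: on them the connection is just
  \<open>\<Gamma>\<close>.\<close>

lemma cov_deriv_const: "cov_deriv \<Gamma> (\<lambda>_. V) (\<lambda>_. W) p = \<Gamma> p V W"
  by (simp add: cov_deriv_def frechet_derivative_const)

text \<open>The difference \<open>\<Gamma> - \<Gamma>'\<close>, lowered with \<open>g\<close>, is symmetric in the first two and
  antisymmetric in the last two arguments, hence zero.\<close>

lemma levi_civita_unique:
  assumes \<Gamma>: "levi_civita U g \<Gamma>" and \<Gamma>': "levi_civita U g \<Gamma>'" and p: "p \<in> U"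
    and bil: "bilinear (g p)" and sym: "\<And>V W. g p V W = g p W V"
    and nondegenerate: "\<And>V. (\<And>W. g p V W = 0) \<Longrightarrow> V = 0"
  shows "\<Gamma> p V W = \<Gamma>' p V W"
proof -
  define b where "b X Y Z = g p (\<Gamma> p X Y - \<Gamma>' p X Y) Z" for X Y Z
  have torsion: "\<Delta> p X Y = \<Delta> p Y X" if "levi_civita U g \<Delta>" for \<Delta> X Y
  proof -
    have "cov_deriv \<Delta> (\<lambda>_. X) (\<lambda>_. Y) p - cov_deriv \<Delta> (\<lambda>_. Y) (\<lambda>_. X) p = lie_bracket (\<lambda>_. X) (\<lambda>_. Y) p"
      using that p unfolding levi_civita_def torsion_free_def by simp
    then show ?thesis by (simp add: cov_deriv_const lie_bracket_def frechet_derivative_const)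
  qed
  have compat: "frechet_derivative (\<lambda>q. g q Y Z) (at p) X = g p (\<Delta> p X Y) Z + g p Y (\<Delta> p X Z)"
    if "levi_civita U g \<Delta>" for \<Delta> X Y Z
    using that[unfolded levi_civita_def metric_compatible_def, THEN conjunct2, THEN conjunct2, rule_format,
        OF p differentiable_const[of X] differentiable_const[of Y] differentiable_const[of Z]]
    by (simp add: cov_deriv_const)
  have b12: "b X Y Z = b Y X Z" for X Y Z
    by (simp add: b_def torsion[OF \<Gamma>, of X Y] torsion[OF \<Gamma>', of X Y])
  have b23: "b X Y Z = - b X Z Y" for X Y Z
    using compat[OF \<Gamma>, of Y Z X] compat[OF \<Gamma>', of Y Z X] sym[of Y "\<Gamma> p X Z"] sym[of Y "\<Gamma>' p X Z"]
    unfolding b_def bilinear_lsub[OF bil] by linarith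
  have "b X Y Z = 0" for X Y Z
    using b12[of X Y Z] b23[of Y X Z] b12[of Y Z X] b23[of Z Y X] b12[of Z X Y] b23[of X Z Y] by linarith
  then have "\<Gamma> p V W - \<Gamma>' p V W = 0"
    by (intro nondegenerate) (simp add: b_def)
  then show ?thesis by simp
qed

text \<open>The average of the two flat connections given by \<open>- V A^-1 W\<close> and
  \<open>- W A^-1 V\<close>, for which the left-invariant and the right-invariant fields
  respectively are parallel. Each preserves the metric by cyclicity of the trace; averaging removes
  the torsion.\<close>

definition trace_christoffel :: "real^'n^'n \<Rightarrow> real^'n^'n \<Rightarrow> real^'n^'n \<Rightarrow> real^'n^'n" where
  "trace_christoffel A V W = - (1 / 2) *\<^sub>R (V ** matrix_inv A ** W + W ** matrix_inv A ** V)"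

lemma trace_christoffel_diag: "trace_christoffel A V V = - (V ** matrix_inv A ** V)"
  unfolding trace_christoffel_def by (simp flip: scaleR_2)

section \<open>The trace metric: derivative, symmetry, nondegeneracy\<close>

lemma bounded_linear_trace: "bounded_linear (trace :: real^'n^'n \<Rightarrow> real)"
  unfolding trace_def by (intro bounded_linear_sum bounded_linear_vec_nth2)

lemmas trace_simps = trace_add trace_sub linear_cmul[OF bounded_linear.linear[OF bounded_linear_trace]]
  linear_neg[OF bounded_linear.linear[OF bounded_linear_trace]]

lemma trace_metric_has_derivative:
  fixes A :: "real^'n^'n"
  assumes A: "A \<in> GL" and Y: "(Y has_derivative Y') (at A)" and Z: "(Z has_derivative Z') (at A)"
  shows "((\<lambda>q. trace_metric q (Y q) (Z q)) has_derivative
    (\<lambda>X. trace_metric A (Y' X) (Z A) + trace_metric A (Y A) (Z' X)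
      - trace (matrix_inv A ** X ** matrix_inv A ** Y A ** matrix_inv A ** Z A)
      - trace (matrix_inv A ** Y A ** matrix_inv A ** X ** matrix_inv A ** Z A))) (at A)"
  unfolding trace_metric_def
  by (rule has_derivative_eq_rhs[OF bounded_linear.has_derivative[OF bounded_linear_trace matrix_mult.FDERIV[OF matrix_mult.FDERIV[OF
      matrix_mult.FDERIV[OF matrix_inv_has_derivative[OF A] Y] matrix_inv_has_derivative[OF A]] Z]]])
    (simp add: fun_eq_iff matrix_mult_simps trace_simps matrix_mul_assoc)

lemma bilinear_trace_metric: "bilinear (trace_metric A)"
  unfolding bilinear_def trace_metric_def
  by (auto intro!: linearI simp: matrix_mult_simps trace_simps)

lemma trace_metric_commute: "trace_metric A V W = trace_metric A W V"
  using trace_mul_sym[of "matrix_inv A ** V" "matrix_inv A ** W"]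
  by (simp add: trace_metric_def matrix_mul_assoc)

lemma trace_mult_transpose: "trace (A ** transpose A) = (norm (A :: real^'n^'m))\<^sup>2"
  by (simp add: trace_def matrix_matrix_mult_def transpose_def power2_norm_eq_inner inner_vec_def)

lemma trace_metric_nondegenerate:
  fixes A :: "real^'n^'n"
  assumes A: "A \<in> GL" and "\<And>W. trace_metric A V W = 0"
  shows "V = 0"
proof -
  have inv: "invertible A" using A by (simp add: GL_def)
  \<comment> \<open>The metric is in general indefinite, so \<open>W = V\<close> is no useful test.
    With \<open>W = transpose M\<close> the metric becomes the squared Euclidean norm of
    \<open>M\<close>.\<close>
  define M where "M = matrix_inv A ** V ** matrix_inv A"
  have "(norm M)\<^sup>2 = trace_metric A V (transpose M)"
    by (simp add: trace_metric_def M_def flip: trace_mult_transpose)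
  then have "M = 0" by (simp add: assms)
  then have "A ** M ** A = 0" by simp
  then show "V = 0" by (simp add: M_def matrix_mul_assoc[symmetric] matrix_inv_cancel inv matrix_inv_left)
qed

lemma levi_civita_trace_christoffel: "levi_civita GL trace_metric (trace_christoffel :: real^'n^'n \<Rightarrow> _)"
  unfolding levi_civita_def
proof (intro conjI ballI)
  show "bilinear (trace_christoffel p)" for p :: "real^'n^'n"
    unfolding bilinear_def trace_christoffel_def
    by (auto intro!: linearI simp: matrix_mult_simps algebra_simps)
  show "torsion_free GL (trace_christoffel :: real^'n^'n \<Rightarrow> _)"
    by (simp add: torsion_free_def cov_deriv_def lie_bracket_def trace_christoffel_def add.commute)
  show "metric_compatible GL trace_metric (trace_christoffel :: real^'n^'n \<Rightarrow> _)"
    unfolding metric_compatible_def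
  proof (intro ballI allI impI)
    fix A :: "real^'n^'n" and X Y Z :: "real^'n^'n \<Rightarrow> real^'n^'n"
    assume A: "A \<in> GL" and Y: "Y differentiable (at A)" and Z: "Z differentiable (at A)"
    have inv: "invertible A" using A by (simp add: GL_def)
    let ?i = "matrix_inv A"
    \<comment> \<open>The two Christoffel terms give four half traces: two coincide as they stand,
      the other two only after a cyclic rotation. The sums are the two traces coming from the
      derivative of the inverses.\<close>
    have cyclic: "trace (?i ** Y A ** ?i ** Z A ** ?i ** X A) = trace (?i ** X A ** ?i ** Y A ** ?i ** Z A)"
      using trace_mul_sym[of "?i ** Y A ** ?i ** Z A" "?i ** X A"] by (simp add: matrix_mul_assoc)
    show "frechet_derivative (\<lambda>q. trace_metric q (Y q) (Z q)) (at A) (X A) =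
      trace_metric A (cov_deriv trace_christoffel X Y A) (Z A) +
      trace_metric A (Y A) (cov_deriv trace_christoffel X Z A)"
      unfolding frechet_derivative_at[OF trace_metric_has_derivative[OF A
          Y[unfolded frechet_derivative_works] Z[unfolded frechet_derivative_works]], symmetric]
      by (simp add: trace_metric_def cov_deriv_def trace_christoffel_def matrix_mult_simps trace_simps
          matrix_mul_assoc cyclic field_simps)
  qed
qed

text \<open>Replaces the existentially quantified \<open>\<Gamma>\<close> of
  \<open>geodesic_on\<close> by the explicit formula.\<close>

lemma levi_civita_trace_metric:
  assumes "levi_civita GL trace_metric \<Gamma>" "A \<in> GL"
  shows "\<Gamma> A V W = trace_christoffel A V W"
  by (rule levi_civita_unique[OF assms(1) levi_civita_trace_christoffel assms(2) bilinear_trace_metric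
        trace_metric_commute trace_metric_nondegenerate[OF assms(2)]])

section \<open>Geodesics\<close>

text \<open>Makes \<open>vector_derivative\<close> within \<open>J\<close> well determined, also
  one-sidedly at endpoints: an interval with more than one point has no isolated points.\<close>

lemma at_within_interval_nontrivial:
  fixes J :: "real set"
  assumes "is_interval J" "interior J \<noteq> {}" "t \<in> J"
  shows "at t within J \<noteq> bot"
proof -
  have "J \<noteq> {x}" for x using assms(2) by auto
  then show ?thesis
    using connected_imp_perfect[OF is_interval_connected[OF assms(1)] assms(3)] trivial_limit_within by blast
qed

text \<open>The right factor \<open>M\<close> lets one rule serve all orders: \<open>mat 1\<close>
  for the velocity, \<open>C\<close> for the acceleration, powers of \<open>C\<close> for
  smoothness.\<close>

lemma exp_curve_has_vector_derivative:
  fixes A K M :: "real^'n^'n"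
  shows "((\<lambda>t. K ** matrix_exp (t *\<^sub>R A) ** M) has_vector_derivative K ** matrix_exp (t *\<^sub>R A) ** (A ** M))
    (at t within J)"
  using has_vector_derivative_matrix_mult[OF has_vector_derivative_matrix_mult[OF has_vector_derivative_const[of K]
        matrix_exp_has_vector_derivative[of A t J]] has_vector_derivative_const[of M]]
  by (simp add: matrix_mul_assoc)

lemma velocity_exp_curve:
  fixes C K :: "real^'n^'n"
  assumes J: "is_interval J" "interior J \<noteq> {}" "t \<in> J"
    and \<gamma>: "\<And>s. s \<in> J \<Longrightarrow> \<gamma> s = K ** matrix_exp (s *\<^sub>R C)"
  shows "velocity J \<gamma> t = K ** matrix_exp (t *\<^sub>R C) ** C"
  unfolding velocity_def
proof (rule vector_derivative_within)
  show "at t within J \<noteq> bot" by (rule at_within_interval_nontrivial[OF J])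
  show "(\<gamma> has_vector_derivative K ** matrix_exp (t *\<^sub>R C) ** C) (at t within J)"
    using exp_curve_has_vector_derivative[of K C "mat 1" t J]
    by (intro has_vector_derivative_transform[OF J(3) \<gamma>]) simp_all
qed

lemma geodesic_on_exp_curve:
  fixes K C :: "real^'n^'n"
  assumes J: "is_interval J" "interior J \<noteq> {}" and K: "K \<in> GL"
    and \<gamma>: "\<And>t. t \<in> J \<Longrightarrow> \<gamma> t = K ** matrix_exp (t *\<^sub>R C)"
  shows "geodesic_on GL trace_metric J \<gamma>"
  unfolding geodesic_on_def
proof (intro conjI exI ballI)
  have inv: "invertible (K ** matrix_exp (t *\<^sub>R C))" for t
    using K by (simp add: GL_def invertible_mult invertible_matrix_exp)
  show "is_interval J" "interior J \<noteq> {}" "\<gamma> ` J \<subseteq> GL"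
    using J \<gamma> inv by (auto simp: GL_def)
  show "levi_civita GL trace_metric (trace_christoffel :: real^'n^'n \<Rightarrow> _)"
    by (rule levi_civita_trace_christoffel)
  show "smooth_curve_on J \<gamma>"
    unfolding smooth_curve_on_def
  \<comment> \<open>The case \<open>k = 0\<close> must be \<open>\<gamma>\<close> itself, because
    \<open>D 0 = \<gamma>\<close> is an equality of functions while \<open>\<gamma>\<close> is known
    only on \<open>J\<close>.\<close>
  proof (intro exI[of _ "\<lambda>k t. if k = 0 then \<gamma> t else K ** matrix_exp (t *\<^sub>R C) ** matrix_pow C k"]
      conjI allI ballI)
    fix k t assume "t \<in> J"
    have "((\<lambda>t. K ** matrix_exp (t *\<^sub>R C) ** matrix_pow C k) has_vector_derivative
        K ** matrix_exp (t *\<^sub>R C) ** matrix_pow C (Suc k)) (at t within J)"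
      using exp_curve_has_vector_derivative[of K C "matrix_pow C k" t J] by simp
    then have "((\<lambda>t. if k = 0 then \<gamma> t else K ** matrix_exp (t *\<^sub>R C) ** matrix_pow C k) has_vector_derivative
       K ** matrix_exp (t *\<^sub>R C) ** matrix_pow C (Suc k)) (at t within J)"
      by (rule has_vector_derivative_transform[OF \<open>t \<in> J\<close>, rotated]) (simp add: \<gamma>)
    then show "((\<lambda>t. if k = 0 then \<gamma> t else K ** matrix_exp (t *\<^sub>R C) ** matrix_pow C k) has_vector_derivative
       (if Suc k = 0 then \<gamma> t else K ** matrix_exp (t *\<^sub>R C) ** matrix_pow C (Suc k))) (at t within J)"
      by (simp only: nat.distinct if_False)
  qed simp
  fix t assume t: "t \<in> J"
  have vel: "velocity J \<gamma> s = K ** matrix_exp (s *\<^sub>R C) ** C" if "s \<in> J" for s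
    by (rule velocity_exp_curve[OF J that \<gamma>])
  have acc: "vector_derivative (velocity J \<gamma>) (at t within J) = K ** matrix_exp (t *\<^sub>R C) ** (C ** C)"
    by (rule vector_derivative_within[OF at_within_interval_nontrivial[OF J t]
          has_vector_derivative_transform[OF t vel exp_curve_has_vector_derivative]])
  define G where "G = K ** matrix_exp (t *\<^sub>R C)"
  have "G ** C ** matrix_inv G ** (G ** C) = G ** (C ** C)"
    using inv[of t] unfolding G_def[symmetric] by (simp add: matrix_mul_assoc matrix_inv_cancel(4))
  then show "cov_deriv_along trace_christoffel J \<gamma> (velocity J \<gamma>) t = 0"
    unfolding cov_deriv_along_def trace_christoffel_diag acc vel[OF t] \<gamma>[OF t] G_def[symmetric] by simp
qed

lemma geodesic_on_imp_exp_curve: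
  fixes \<gamma> :: "real \<Rightarrow> real^'n^'n"
  assumes "geodesic_on GL trace_metric J \<gamma>"
  obtains K C where "K \<in> GL" "\<And>t. t \<in> J \<Longrightarrow> \<gamma> t = K ** matrix_exp (t *\<^sub>R C)"
proof -
  have J: "is_interval J" "interior J \<noteq> {}" and GL: "\<And>t. t \<in> J \<Longrightarrow> \<gamma> t \<in> GL"
    and smooth: "smooth_curve_on J \<gamma>"
    using assms by (auto simp: geodesic_on_def)
  obtain \<Gamma> where \<Gamma>: "levi_civita GL trace_metric \<Gamma>"
    and geo: "\<And>t. t \<in> J \<Longrightarrow> cov_deriv_along \<Gamma> J \<gamma> (velocity J \<gamma>) t = 0"
    using assms by (auto simp: geodesic_on_def)
  obtain D where D: "D 0 = \<gamma>"
    "\<And>k t. t \<in> J \<Longrightarrow> (D k has_vector_derivative D (Suc k) t) (at t within J)"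
    using smooth by (auto simp: smooth_curve_on_def)
  define v where "v = velocity J \<gamma>"
  note nontriv = at_within_interval_nontrivial[OF J]
  have v_D: "v t = D 1 t" if "t \<in> J" for t
    using vector_derivative_within[OF nontriv[OF that] D(2)[OF that, of 0]]
    by (simp add: v_def velocity_def D(1))
  have \<gamma>': "(\<gamma> has_vector_derivative v t) (at t within J)" if "t \<in> J" for t
    using D(2)[OF that, of 0] v_D[OF that] by (simp add: D(1))
  have v': "(v has_vector_derivative v t ** matrix_inv (\<gamma> t) ** v t) (at t within J)" if t: "t \<in> J" for t
  proof -
    have v2: "(v has_vector_derivative D 2 t) (at t within J)"
      using D(2)[OF t, of 1] by (intro has_vector_derivative_transform[OF t v_D]) (simp_all add: numeral_2_eq_2)
    have "D 2 t - v t ** matrix_inv (\<gamma> t) ** v t = 0"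
      using geo[OF t, unfolded cov_deriv_along_def v_def[symmetric] vector_derivative_within[OF nontriv[OF t] v2]
          levi_civita_trace_metric[OF \<Gamma> GL[OF t]] trace_christoffel_diag]
      by simp
    then show ?thesis using v2 by simp
  qed
  have conv: "convex J" using J(1) by (simp add: is_interval_convex_1)
  have inv: "invertible (\<gamma> t)" if "t \<in> J" for t using GL[OF that] by (simp add: GL_def)
  have inv': "((\<lambda>t. matrix_inv (\<gamma> t)) has_vector_derivative - (matrix_inv (\<gamma> t) ** v t ** matrix_inv (\<gamma> t)))
      (at t within J)" if t: "t \<in> J" for t
    using vector_derivative_diff_chain_within[OF \<gamma>'[OF t] has_derivative_at_withinI[OF matrix_inv_has_derivative[OF GL[OF t]]]]
    by (simp add: o_def)
  \<comment> \<open>The derivative of the inverse contributes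
    \<open>- \<gamma>^-1 v \<gamma>^-1 v\<close>, and the geodesic equation contributes the same
    product with a plus sign.\<close>
  have "((\<lambda>t. matrix_inv (\<gamma> t) ** v t) has_vector_derivative 0) (at t within J)" if t: "t \<in> J" for t
    using has_vector_derivative_matrix_mult[OF inv'[OF t] v'[OF t]]
    by (simp add: matrix_mult_simps matrix_mul_assoc)
  then have "\<exists>C. \<forall>t\<in>J. matrix_inv (\<gamma> t) ** v t = C"
    by (intro has_derivative_zero_constant[OF conv]) (simp add: has_vector_derivative_def)
  then obtain C where C: "\<And>t. t \<in> J \<Longrightarrow> matrix_inv (\<gamma> t) ** v t = C" by blast
  have v_C: "v t = \<gamma> t ** C" if "t \<in> J" for t
    using C[OF that] matrix_eq_inv_mult_iff[OF inv[OF that]] by metis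
  have "((\<lambda>t. \<gamma> t ** matrix_exp ((- t) *\<^sub>R C)) has_vector_derivative 0) (at t within J)" if t: "t \<in> J" for t
    using has_vector_derivative_matrix_mult[OF \<gamma>'[OF t] matrix_exp_minus_has_vector_derivative[of C t J]]
    by (simp add: matrix_mult_simps matrix_mul_assoc v_C t)
  then have "\<exists>K. \<forall>t\<in>J. \<gamma> t ** matrix_exp ((- t) *\<^sub>R C) = K"
    by (intro has_derivative_zero_constant[OF conv]) (simp add: has_vector_derivative_def)
  then obtain K where K: "\<And>t. t \<in> J \<Longrightarrow> \<gamma> t ** matrix_exp ((- t) *\<^sub>R C) = K" by blast
  show thesis
  proof
    \<comment> \<open>\<open>0\<close> may lie outside \<open>J\<close>, so \<open>K\<close> need
      not be a point of the curve; its invertibility is read off at an arbitrary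
      \<open>t\<close>.\<close>
    obtain t where "t \<in> J" using J(2) interior_subset by blast
    then show "K \<in> GL"
      using K[of t] inv[of t] invertible_mult[OF inv[of t] invertible_matrix_exp[of "- t" C]]
      by (simp add: GL_def)
    show "\<gamma> t = K ** matrix_exp (t *\<^sub>R C)" if "t \<in> J" for t
      using matrix_exp_minus_mult[of t C] by (simp flip: K[OF that] matrix_mul_assoc)
  qed
qed

section \<open>Geodesics with given initial data or given endpoints\<close>

lemma unique_geodesic_from_exp:
  fixes K C :: "real^'n^'n"
  assumes K: "K \<in> GL"
  shows "unique_geodesic_from GL trace_metric K (K ** C) (\<lambda>t. K ** matrix_exp (t *\<^sub>R C))"
  unfolding unique_geodesic_from_def
proof (intro conjI allI impI ballI)
  show "geodesic_on GL trace_metric UNIV (\<lambda>t. K ** matrix_exp (t *\<^sub>R C))"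
    by (rule geodesic_on_exp_curve[OF _ _ K]) simp_all
  show "K ** matrix_exp (0 *\<^sub>R C) = K" by (simp add: matrix_exp_0)
  show "velocity UNIV (\<lambda>t. K ** matrix_exp (t *\<^sub>R C)) 0 = K ** C"
    using velocity_exp_curve[of UNIV 0 _ K C] by (simp add: matrix_exp_0)
  fix J \<gamma> t
  assume "geodesic_on GL trace_metric J \<gamma> \<and> 0 \<in> J \<and> \<gamma> 0 = K \<and> velocity J \<gamma> 0 = K ** C" and t: "t \<in> J"
  then have geo: "geodesic_on GL trace_metric J \<gamma>" and 0: "0 \<in> J" "\<gamma> 0 = K" "velocity J \<gamma> 0 = K ** C"
    by auto
  obtain K' C' where K': "K' \<in> GL" and \<gamma>: "\<And>t. t \<in> J \<Longrightarrow> \<gamma> t = K' ** matrix_exp (t *\<^sub>R C')"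
    by (rule geodesic_on_imp_exp_curve[OF geo]) blast
  have [simp]: "K' = K" using \<gamma>[OF 0(1)] 0(2) by (simp add: matrix_exp_0)
  have "K ** C' = K ** C"
    using velocity_exp_curve[OF _ _ 0(1) \<gamma>] 0(3) geo by (simp add: geodesic_on_def matrix_exp_0)
  then have "C' = C" using K by (simp add: GL_def matrix_mult_left_cancel)
  then show "\<gamma> t = K ** matrix_exp (t *\<^sub>R C)" using \<gamma>[OF t] by simp
qed

text \<open>\<open>restrict\<close> and \<open>extensional\<close> identify curves that agree on
  \<open>J\<close>, which a bijection requires of total functions. A general \<open>J\<close> covers
  both arcs on \<open>{0..1}\<close> and complete geodesics.\<close>

lemma bij_betw_geodesics_joining:
  fixes K0 K1 :: "real^'n^'n"
  assumes K0: "K0 \<in> GL" and J: "is_interval J" "{0..1} \<subseteq> J"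
  shows "bij_betw (\<lambda>C. restrict (\<lambda>t. K0 ** matrix_exp (t *\<^sub>R C)) J)
    {C. matrix_exp C = matrix_inv K0 ** K1}
    {\<gamma>. \<gamma> \<in> extensional J \<and> geodesic_on GL trace_metric J \<gamma> \<and> \<gamma> 0 = K0 \<and> \<gamma> 1 = K1}"
    (is "bij_betw ?F ?S ?G")
proof -
  have inv: "invertible K0" using K0 by (simp add: GL_def)
  have int: "interior J \<noteq> {}"
    using interior_mono[OF J(2)] by (auto simp: interior_atLeastAtMost_real)
  have J01: "0 \<in> J" "1 \<in> J" using J(2) by auto
  show ?thesis
    unfolding bij_betw_def
  proof (intro conjI inj_onI equalityI subsetI)
    fix C C' assume eq: "?F C = ?F C'"
    \<comment> \<open>All these curves share their points at \<open>0\<close> and \<open>1\<close>;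
      the initial velocity separates them.\<close>
    have "velocity J (?F B) 0 = K0 ** B" for B
      using velocity_exp_curve[OF J(1) int J01(1), of "?F B" K0 B] by (simp add: matrix_exp_0)
    then have "K0 ** C = K0 ** C'" using eq by metis
    then show "C = C'" by (simp add: inv matrix_mult_left_cancel)
  next
    fix \<gamma> assume "\<gamma> \<in> ?F ` ?S"
    then obtain C where C: "matrix_exp C = matrix_inv K0 ** K1" and \<gamma>: "\<gamma> = ?F C" by blast
    have "geodesic_on GL trace_metric J \<gamma>"
      by (rule geodesic_on_exp_curve[OF J(1) int K0]) (simp add: \<gamma>)
    then show "\<gamma> \<in> ?G"
      by (simp add: \<gamma> J01 C matrix_exp_0 matrix_inv_cancel inv)
  next
    fix \<gamma> assume "\<gamma> \<in> ?G"
    then have ext: "\<gamma> \<in> extensional J" and geo: "geodesic_on GL trace_metric J \<gamma>"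
      and ends: "\<gamma> 0 = K0" "\<gamma> 1 = K1" by auto
    obtain K C where \<gamma>: "\<And>t. t \<in> J \<Longrightarrow> \<gamma> t = K ** matrix_exp (t *\<^sub>R C)"
      by (rule geodesic_on_imp_exp_curve[OF geo]) blast
    have [simp]: "K = K0" using \<gamma>[OF J01(1)] ends by (simp add: matrix_exp_0)
    have "matrix_exp C = matrix_inv K0 ** K1"
      unfolding matrix_eq_inv_mult_iff[OF inv] using \<gamma>[OF J01(2)] ends by simp
    moreover have "\<gamma> = ?F C"
      by (rule extensionalityI[OF ext restrict_extensional]) (simp add: \<gamma>)
    ultimately show "\<gamma> \<in> ?F ` ?S" by blast
  qed
qed

lemma ex_geodesic_arc_iff:
  fixes K0 K1 :: "real^'n^'n"
  assumes K0: "K0 \<in> GL"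
  shows "(\<exists>\<gamma>. geodesic_arc GL trace_metric K0 K1 \<gamma>) \<longleftrightarrow> (\<exists>C. matrix_exp C = matrix_inv K0 ** K1)"
proof -
  have inv: "invertible K0" using K0 by (simp add: GL_def)
  show ?thesis
  proof
    assume "\<exists>\<gamma>. geodesic_arc GL trace_metric K0 K1 \<gamma>"
    then obtain \<gamma> where geo: "geodesic_on GL trace_metric {0..1} \<gamma>" and ends: "\<gamma> 0 = K0" "\<gamma> 1 = K1"
      by (auto simp: geodesic_arc_def)
    obtain K C where \<gamma>: "\<And>t. t \<in> {0..1} \<Longrightarrow> \<gamma> t = K ** matrix_exp (t *\<^sub>R C)"
      by (rule geodesic_on_imp_exp_curve[OF geo]) blast
    show "\<exists>C. matrix_exp C = matrix_inv K0 ** K1"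
      unfolding matrix_eq_inv_mult_iff[OF inv]
      using \<gamma>[of 0] \<gamma>[of 1] ends by (intro exI[of _ C]) (simp add: matrix_exp_0)
  next
    assume "\<exists>C. matrix_exp C = matrix_inv K0 ** K1"
    then obtain C where C: "matrix_exp C = matrix_inv K0 ** K1" ..
    have "geodesic_on GL trace_metric {0..1} (\<lambda>t. K0 ** matrix_exp (t *\<^sub>R C))"
      by (rule geodesic_on_exp_curve[OF _ _ K0]) (simp_all add: interior_atLeastAtMost_real is_interval_cc)
    then show "\<exists>\<gamma>. geodesic_arc GL trace_metric K0 K1 \<gamma>"
      unfolding geodesic_arc_def
      by (intro exI[of _ "\<lambda>t. K0 ** matrix_exp (t *\<^sub>R C)"]) (simp add: C matrix_exp_0 matrix_inv_cancel inv)
  qed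
qed

section \<open>The positive definite square root\<close>

lemma inner_symmetric_matrix:
  fixes A :: "real^'n^'n"
  assumes "symmetric_matrix A"
  shows "(A *v x) \<bullet> y = x \<bullet> (A *v y)"
  using assms by (metis dot_lmul_matrix symmetric_matrix_def transpose_matrix_vector inner_commute)

lemma symmetric_matrixI:
  fixes A :: "real^'n^'n"
  assumes "\<And>x y. (A *v x) \<bullet> y = x \<bullet> (A *v y)"
  shows "symmetric_matrix A"
proof -
  have "A $ i $ j = A $ j $ i" for i j
    using assms[of "axis j 1" "axis i 1"]
    by (simp add: matrix_vector_mult_basis column_def inner_axis inner_axis')
  then show ?thesis by (simp add: symmetric_matrix_def transpose_def vec_eq_iff)
qed

lemma pos_def_matrix_invertible:
  fixes A :: "real^'n^'n"
  assumes "pos_def_matrix A"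
  shows "invertible A"
proof -
  have "x = 0" if "A *v x = 0" for x
    using assms that by (force simp: pos_def_matrix_def)
  then show ?thesis
    using matrix_left_invertible_ker invertible_left_inverse by blast
qed

section \<open>Uniqueness of the square root by traces\<close>

lemma trace_congruence: "trace (transpose D ** A ** D) = (\<Sum>j\<in>UNIV. column j D \<bullet> (A *v column j (D :: real^'n^'n)))"
proof -
  have "(transpose D ** (A ** D)) $ j $ j = column j D \<bullet> (A *v column j D)" for j
    by (simp add: matrix_matrix_mult_def transpose_def column_def inner_vec_def matrix_vector_mult_def)
  then show ?thesis by (simp add: trace_def flip: matrix_mul_assoc)
qed

text \<open>The trace is the sum of the quadratic form of \<open>A\<close> over the columns of
  \<open>D\<close>, so it vanishes only if every column does.\<close>

lemma pos_def_trace_congruence: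
  fixes A D :: "real^'n^'n"
  assumes "pos_def_matrix A"
  shows "trace (transpose D ** A ** D) \<ge> 0" "trace (transpose D ** A ** D) = 0 \<Longrightarrow> D = 0"
proof -
  have nonneg: "x \<bullet> (A *v x) \<ge> 0" for x
    using assms by (cases "x = 0") (auto simp: pos_def_matrix_def less_imp_le)
  then show "trace (transpose D ** A ** D) \<ge> 0"
    by (simp add: trace_congruence sum_nonneg)
  assume "trace (transpose D ** A ** D) = 0"
  then have "column j D = 0" for j
    using assms nonneg by (auto simp: trace_congruence sum_nonneg_eq_0_iff pos_def_matrix_def)
  then show "D = 0" by (simp add: column_def vec_eq_iff)
qed

text \<open>The difference \<open>D\<close> of two square roots satisfies \<open>R D + D Q = 0\<close>; multiply by \<open>D\<close> and
  take the trace.\<close>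

lemma pos_def_sqrt_unique:
  fixes R Q :: "real^'n^'n"
  assumes R: "pos_def_matrix R" and Q: "pos_def_matrix Q" and eq: "R ** R = Q ** Q"
  shows "R = Q"
proof -
  define D where "D = R - Q"
  have sym: "transpose D = D"
    using R Q by (simp add: D_def pos_def_matrix_def symmetric_matrix_def transpose_def vec_eq_iff)
  have "R ** D + D ** Q = 0"
    by (simp add: D_def matrix_mult_simps eq)
  then have "trace (D ** (R ** D + D ** Q)) = 0" by (simp add: trace_def)
  then have "trace (D ** R ** D) + trace (D ** D ** Q) = 0"
    by (simp add: matrix_mult_simps trace_add matrix_mul_assoc)
  moreover have "trace (D ** D ** Q) = trace (D ** Q ** D)"
    using trace_mul_sym[of D "D ** Q"] by (simp add: matrix_mul_assoc)
  ultimately have "trace (D ** R ** D) = 0"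
    using pos_def_trace_congruence(1)[OF R, of D] pos_def_trace_congruence(1)[OF Q, of D]
    by (simp add: sym)
  then have "D = 0"
    using pos_def_trace_congruence(2)[OF R, of D] by (simp add: sym)
  then show ?thesis by (simp add: D_def)
qed

section \<open>Existence of the square root by contraction\<close>

lemma pos_def_lower_bound:
  fixes A :: "real^'n^'n"
  assumes "pos_def_matrix A"
  obtains m where "m > 0" "\<And>x. x \<bullet> (A *v x) \<ge> m * (norm x)\<^sup>2"
proof -
  \<comment> \<open>The form attains its minimum on the compact unit sphere; homogeneity carries
    this bound to all vectors.\<close>
  have cont: "continuous_on (sphere 0 1) (\<lambda>x. x \<bullet> (A *v x))"
    by (intro continuous_intros linear_continuous_on matrix_vector_mul_bounded_linear)
  have "sphere (0 :: real^'n) 1 \<noteq> {}" by simp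
  then obtain u where u: "u \<in> sphere 0 1" and min: "\<And>x. x \<in> sphere 0 1 \<Longrightarrow> u \<bullet> (A *v u) \<le> x \<bullet> (A *v x)"
    using continuous_attains_inf[OF compact_sphere _ cont] by blast
  show thesis
  proof
    have "u \<noteq> 0" using u by auto
    then show "u \<bullet> (A *v u) > 0" using assms by (simp add: pos_def_matrix_def)
    show "x \<bullet> (A *v x) \<ge> (u \<bullet> (A *v u)) * (norm x)\<^sup>2" for x
    proof (cases "x = 0")
      case False
      define y where "y = x /\<^sub>R norm x"
      have x: "x = norm x *\<^sub>R y" using False by (simp add: y_def)
      have "u \<bullet> (A *v u) \<le> y \<bullet> (A *v y)" using False by (intro min) (simp add: y_def)
      then have "(u \<bullet> (A *v u)) * (norm x)\<^sup>2 \<le> (y \<bullet> (A *v y)) * (norm x)\<^sup>2"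
        by (rule mult_right_mono) simp
      also have "\<dots> = x \<bullet> (A *v x)"
        by (subst (2 3) x) (simp add: matrix_vector_mult_scaleR power2_eq_square)
      finally show ?thesis .
    qed simp
  qed
qed

text \<open>\<open>1 - Y\<close> is a square root of \<open>1 - B\<close>; \<open>Y\<close> is the fixed point of the contraction
  \<open>Y \<mapsto> (B + Y\<^sup>2) / 2\<close> of the ball of radius \<open>r\<close>.\<close>

lemma contraction_sqrt:
  fixes B :: "'a::euclidean_space \<Rightarrow>\<^sub>L 'a"
  assumes norm: "norm B \<le> r" "r < 1" and sym: "\<And>x y. B x \<bullet> y = x \<bullet> B y"
  obtains Y :: "'a \<Rightarrow>\<^sub>L 'a" where "norm Y \<le> r" "\<And>x y. Y x \<bullet> y = x \<bullet> Y y" "\<And>x. 2 *\<^sub>R Y x = B x + Y (Y x)"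
proof -
  have r: "r \<ge> 0" using norm(1) norm_ge_zero[of B] by linarith
  define f where "f Y = (1 / 2) *\<^sub>R (B + (Y o\<^sub>L Y))" for Y :: "'a \<Rightarrow>\<^sub>L 'a"
  \<comment> \<open>Symmetry is a closed condition preserved by \<open>f\<close>; built into the
    complete set \<open>S\<close>, it passes to the fixed point.\<close>
  define S where "S = cball 0 r \<inter> (\<Inter>x y. {Y :: 'a \<Rightarrow>\<^sub>L 'a. Y x \<bullet> y = x \<bullet> Y y})"
  have f_apply: "blinfun_apply (f Y) x = (1 / 2) *\<^sub>R (B x + Y (Y x))" for Y x
    by (simp add: f_def blinfun.add_left blinfun.scaleR_left)
  have "\<exists>!Y\<in>S. f Y = Y"
  proof (rule Banach_fix[OF _ _ r norm(2)])
    have "closed {Y :: 'a \<Rightarrow>\<^sub>L 'a. Y x \<bullet> y = x \<bullet> Y y}" for x y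
      by (intro closed_Collect_eq continuous_intros)
    then show "complete S"
      unfolding S_def complete_eq_closed by (intro closed_Int closed_cball closed_INT ballI)
    have "0 \<in> S" using r by (simp add: S_def)
    then show "S \<noteq> {}" by blast
    show "f ` S \<subseteq> S"
    proof
      fix Z assume "Z \<in> f ` S"
      then obtain Y :: "'a \<Rightarrow>\<^sub>L 'a"
        where Y: "norm Y \<le> r" "\<And>x y. Y x \<bullet> y = x \<bullet> Y y" and Z: "Z = f Y"
        by (auto simp: S_def)
      have "norm (Y o\<^sub>L Y) \<le> norm Y * norm Y" by (rule norm_blinfun_compose)
      also have "\<dots> \<le> r * r" using Y(1) r by (intro mult_mono) auto
      also have "\<dots> \<le> r" using r norm(2) mult_left_mono[of r 1 r] by simp
      finally have "norm (B + (Y o\<^sub>L Y)) \<le> r + r" using norm(1) by (intro norm_triangle_le) linarith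
      then have "norm Z \<le> r" by (simp add: Z f_def)
      moreover have "Z x \<bullet> y = x \<bullet> Z y" for x y
        by (simp add: Z f_apply inner_add_left inner_add_right sym Y(2))
      ultimately show "Z \<in> S" by (auto simp: S_def)
    qed
    fix Y Z assume "Y \<in> S" "Z \<in> S"
    then have YZ: "norm Y \<le> r" "norm Z \<le> r" by (auto simp: S_def)
    \<comment> \<open>The splitting \<open>Y Y - Z Z = Y (Y - Z) + (Y - Z) Z\<close> respects
      noncommutativity; each half costs a factor \<open>r\<close>, and the prefactor
      \<open>1 / 2\<close> leaves Lipschitz constant \<open>r\<close>.\<close>
    have "f Y - f Z = (1 / 2) *\<^sub>R ((Y o\<^sub>L (Y - Z)) + ((Y - Z) o\<^sub>L Z))"
      by (rule blinfun_eqI) (simp add: f_apply blinfun.add_left blinfun.diff_left blinfun.scaleR_left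
          blinfun.diff_right flip: scaleR_diff_right)
    moreover have "norm ((Y o\<^sub>L (Y - Z)) + ((Y - Z) o\<^sub>L Z)) \<le> norm Y * norm (Y - Z) + norm (Y - Z) * norm Z"
      by (intro norm_triangle_mono norm_blinfun_compose)
    moreover have "norm Y * norm (Y - Z) + norm (Y - Z) * norm Z \<le> r * norm (Y - Z) + norm (Y - Z) * r"
      using YZ by (intro add_mono mult_right_mono mult_left_mono) auto
    ultimately show "dist (f Y) (f Z) \<le> r * dist Y Z"
      by (simp add: dist_norm)
  qed
  then obtain Y where Y: "Y \<in> S" "f Y = Y" by blast
  show thesis
  proof
    show "norm Y \<le> r" "Y x \<bullet> y = x \<bullet> Y y" for x y using Y(1) by (auto simp: S_def)
    show "2 *\<^sub>R Y x = B x + Y (Y x)" for x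
    proof -
      have "2 *\<^sub>R f Y x = B x + Y (Y x)" by (simp add: f_apply)
      then show ?thesis by (simp only: Y(2))
    qed
  qed
qed

text \<open>With \<open>B = 1 - e K\<close> and \<open>2 Y = B + Y Y\<close>, the square of
  \<open>1 - Y\<close> is \<open>1 - B = e K\<close>, so \<open>R = (1 - Y) / sqrt e\<close> works.
  The bound \<open>norm Y \<le> r < 1\<close> makes \<open>R\<close> positive definite.\<close>

lemma pos_def_sqrt_exists:
  fixes K :: "real^'n^'n"
  assumes K: "pos_def_matrix K"
  obtains R where "pos_def_matrix R" "R ** R = K"
proof -
  obtain m where m: "m > 0" "\<And>x. x \<bullet> (K *v x) \<ge> m * (norm x)\<^sup>2"
    using pos_def_lower_bound[OF K] by blast
  obtain M where M: "M > 0" "\<And>x. norm (K *v x) \<le> norm x * M"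
    using bounded_linear.pos_bounded[OF matrix_vector_mul_bounded_linear[of K]] by blast
  \<comment> \<open>This \<open>e\<close> minimizes
    \<open>1 - 2 * e * m + e\<^sup>2 * M\<^sup>2\<close>, the factor bounding
    \<open>(norm (B x))\<^sup>2\<close>; the minimum is
    \<open>1 - m\<^sup>2 / M\<^sup>2\<close>.\<close>
  define e where "e = m / M\<^sup>2"
  have e: "e > 0" using m M by (simp add: e_def)
  define A where "A = mat 1 - e *\<^sub>R K"
  define B where "B = Blinfun ((*v) A)"
  have B: "blinfun_apply B x = x - e *\<^sub>R (K *v x)" for x
    by (simp add: B_def A_def bounded_linear_Blinfun_apply matrix_vector_mult_diff_rdistrib
        scaleR_matrix_vector_assoc)
  define r where "r = sqrt (1 - m\<^sup>2 / M\<^sup>2)"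
  have r1: "r < 1" using m M by (simp add: r_def)
  have bound: "norm (B x) \<le> r * norm x" for x
  proof -
    have "(norm (B x))\<^sup>2 = (norm x)\<^sup>2 - 2 * e * (x \<bullet> (K *v x)) + e\<^sup>2 * (norm (K *v x))\<^sup>2"
      unfolding B power2_norm_eq_inner by (simp add: inner_diff inner_commute power2_eq_square algebra_simps)
    also have "\<dots> \<le> (norm x)\<^sup>2 - 2 * e * (m * (norm x)\<^sup>2) + e\<^sup>2 * (norm x * M)\<^sup>2"
      using e m(2)[of x] power_mono[OF M(2)[of x], of 2]
      by (intro add_mono diff_mono mult_left_mono) auto
    also have "\<dots> = (1 - m\<^sup>2 / M\<^sup>2) * (norm x)\<^sup>2"
      using M(1) by (simp add: e_def field_simps power2_eq_square)
    finally have "sqrt ((norm (B x))\<^sup>2) \<le> sqrt ((1 - m\<^sup>2 / M\<^sup>2) * (norm x)\<^sup>2)"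
      by (rule real_sqrt_le_mono)
    then show ?thesis by (simp add: r_def real_sqrt_mult)
  qed
  \<comment> \<open>\<open>sqrt\<close> takes negative values on negative reals, so the sign of
    \<open>r\<close> is obtained from the bound at a unit vector.\<close>
  have "0 \<le> r"
    using order_trans[OF norm_ge_zero bound[of "axis undefined 1"]] by simp
  then have "norm B \<le> r" using bound by (intro norm_blinfun_bound) (auto simp: mult.commute)
  moreover have "B x \<bullet> y = x \<bullet> B y" for x y
    using K inner_symmetric_matrix[of K x y] by (simp add: B pos_def_matrix_def inner_diff)
  ultimately obtain Y :: "(real^'n) \<Rightarrow>\<^sub>L (real^'n)"
    where Y: "norm Y \<le> r" "\<And>x y. Y x \<bullet> y = x \<bullet> Y y" "\<And>x. 2 *\<^sub>R Y x = B x + Y (Y x)"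
    using contraction_sqrt[of B r] r1 by blast
  define R where "R = (1 / sqrt e) *\<^sub>R (mat 1 - matrix (blinfun_apply Y))"
  have "linear (blinfun_apply Y)" by (simp add: blinfun.bounded_linear_right bounded_linear.linear)
  then have R: "R *v x = (1 / sqrt e) *\<^sub>R (x - Y x)" for x
    by (simp add: R_def matrix_vector_mult_diff_rdistrib matrix_works flip: scaleR_matrix_vector_assoc)
  show thesis
  proof
    have "(R ** R) *v x = K *v x" for x
    proof -
      have "(R ** R) *v x = (1 / e) *\<^sub>R (x - 2 *\<^sub>R Y x + Y (Y x))"
        using e by (simp add: R blinfun.diff_right blinfun.scaleR_right scaleR_2 algebra_simps
            flip: matrix_vector_mul_assoc)
      also have "\<dots> = (1 / e) *\<^sub>R (e *\<^sub>R (K *v x))" by (simp add: Y(3) B)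
      finally show ?thesis using e by simp
    qed
    then show "R ** R = K" by (simp add: matrix_eq)
    have "symmetric_matrix R"
      by (intro symmetric_matrixI) (simp add: R Y(2) inner_diff)
    moreover have "x \<bullet> (R *v x) > 0" if "x \<noteq> 0" for x
    proof -
      have "x \<bullet> Y x \<le> norm x * norm (Y x)" by (rule norm_cauchy_schwarz)
      also have "\<dots> \<le> norm x * (r * norm x)"
        using norm_blinfun[of Y x] Y(1) by (intro mult_left_mono order_trans[OF norm_blinfun] mult_right_mono) auto
      also have "\<dots> < norm x * (1 * norm x)"
        using r1 that by (intro mult_strict_left_mono mult_strict_right_mono) auto
      finally show ?thesis
        using e by (simp add: R inner_diff_right power2_norm_eq_inner flip: power2_eq_square)
    qed
    ultimately show "pos_def_matrix R" by (simp add: pos_def_matrix_def)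
  qed
qed

lemma ex1_pos_def_sqrt:
  fixes K :: "real^'n^'n"
  assumes "pos_def_matrix K"
  shows "\<exists>!R. pos_def_matrix R \<and> R ** R = K"
  by (rule pos_def_sqrt_exists[OF assms]) (auto intro: pos_def_sqrt_unique)

text \<open>With \<open>R = matrix_sqrt K\<close> and \<open>C = R^-1 R^-1 S\<close>, the relation
  \<open>(R^-1 S R^-1) R = R C\<close> moves the right factor \<open>R\<close> through the
  exponential. The curve becomes \<open>R R exp(t C) = K exp(t C)\<close>, with velocity
  \<open>K C = S\<close> at \<open>0\<close>.\<close>

lemma unique_geodesic_from_sqrt:
  fixes K S :: "real^'n^'n"
  assumes "pos_def_matrix K"
  shows "unique_geodesic_from GL trace_metric K S
    (\<lambda>t. matrix_sqrt K
       ** matrix_exp (t *\<^sub>R (matrix_inv (matrix_sqrt K) ** S ** matrix_inv (matrix_sqrt K)))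
       ** matrix_sqrt K)"
proof -
  define R where "R = matrix_sqrt K"
  have R: "pos_def_matrix R" "R ** R = K"
    using theI'[OF ex1_pos_def_sqrt[OF assms]] by (simp_all add: R_def matrix_sqrt_def)
  define C where "C = matrix_inv R ** (matrix_inv R ** S)"
  have inv: "invertible R" by (rule pos_def_matrix_invertible[OF R(1)])
  have K: "K \<in> GL" using R(2) invertible_mult[OF inv inv] by (simp add: GL_def)
  have "R ** matrix_exp (t *\<^sub>R (matrix_inv R ** S ** matrix_inv R)) ** R = K ** matrix_exp (t *\<^sub>R C)" for t
  proof -
    have "(t *\<^sub>R (matrix_inv R ** S ** matrix_inv R)) ** R = R ** (t *\<^sub>R C)"
      by (simp add: C_def matrix_mult_simps matrix_inv_cancel inv)
    from matrix_exp_intertwine[OF this] show ?thesis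
      by (simp flip: matrix_mul_assoc R(2))
  qed
  moreover have "K ** C = S"
    unfolding C_def R(2)[symmetric] matrix_mul_assoc[symmetric] by (simp add: matrix_inv_cancel inv)
  ultimately show ?thesis
    using unique_geodesic_from_exp[OF K, of C] by (simp add: R_def)
qed

theorem corollary2p2:
  shows
    "(\<forall>(K :: real^'n^'n) C. K \<in> GL \<longrightarrow>
        unique_geodesic_from GL trace_metric K (K ** C) (\<lambda>t. K ** matrix_exp (t *\<^sub>R C))) \<and>
     (\<forall>(K :: real^'n^'n) S. K \<in> GL \<longrightarrow>
        unique_geodesic_from GL trace_metric K S (\<lambda>t. K ** matrix_exp (t *\<^sub>R (matrix_inv K ** S)))) \<and>
     (\<forall>(K0 :: real^'n^'n) K1. K0 \<in> GL \<and> K1 \<in> GL \<longrightarrow>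
        ((\<exists>\<gamma>. geodesic_arc GL trace_metric K0 K1 \<gamma>) \<longleftrightarrow>
           (\<exists>C. matrix_exp C = matrix_inv K0 ** K1)) \<and>
        (\<forall>J. is_interval J \<and> {0..1} \<subseteq> J \<longrightarrow>
           bij_betw (\<lambda>C. restrict (\<lambda>t. K0 ** matrix_exp (t *\<^sub>R C)) J)
             {C. matrix_exp C = matrix_inv K0 ** K1}
             {\<gamma>. \<gamma> \<in> extensional J \<and> geodesic_on GL trace_metric J \<gamma> \<and> \<gamma> 0 = K0 \<and> \<gamma> 1 = K1})) \<and>
     (\<forall>(K :: real^'n^'n) S. pos_def_matrix K \<and> symmetric_matrix S \<longrightarrow>
        (\<exists>!R. pos_def_matrix R \<and> R ** R = K) \<and>
        unique_geodesic_from GL trace_metric K S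
          (\<lambda>t. matrix_sqrt K
             ** matrix_exp (t *\<^sub>R (matrix_inv (matrix_sqrt K) ** S ** matrix_inv (matrix_sqrt K)))
             ** matrix_sqrt K))"
proof (intro conjI allI impI; (elim conjE)?)
  fix K C S :: "real^'n^'n" assume K: "K \<in> GL"
  show "unique_geodesic_from GL trace_metric K (K ** C) (\<lambda>t. K ** matrix_exp (t *\<^sub>R C))"
    by (rule unique_geodesic_from_exp[OF K])
  show "unique_geodesic_from GL trace_metric K S (\<lambda>t. K ** matrix_exp (t *\<^sub>R (matrix_inv K ** S)))"
    using unique_geodesic_from_exp[OF K, of "matrix_inv K ** S"] K by (simp add: GL_def matrix_inv_cancel)
qed (use ex_geodesic_arc_iff bij_betw_geodesics_joining ex1_pos_def_sqrt unique_geodesic_from_sqrt in blast)+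

end
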